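(* Let $\Lambda$ be a $k$-graph. Then $\widetilde{Q}(\Lambda)=\big(\widetilde{Q}_r(\Lambda),\overline{\varepsilon}^\ell_i,\overline{\eta}_i\big)$ is a cubical set, with faces $\overline{\varepsilon}^\ell_i$ and degeneracies $\overline{\eta}_i$.
   Context: Conventions: $0\in\mathbb{N}$ and $\mathbb{N}^0=\{0\}$. A $k$-graph ($k\ge0$) is a nonempty countable small category $\Lambda$ with a functor $d_\Lambda:\Lambda\to\mathbb{N}^k$ (the degree) satisfying the factorisation property: whenever $d_\Lambda(\lambda)=m+n$ there are unique $\mu,\nu\in\Lambda$ with $d_\Lambda(\mu)=m$, $d_\Lambda(\nu)=n$, $\lambda=\mu\nu$. $e_i$ denote the standard generators of $\mathbb{N}^k$, $\mathbf{1}_r=\sum_{i=1}^re_i\in\mathbb{N}^r$, $\le$ is coordinatewise. A quasimorphism from a $k$-graph $(\Lambda,d)$ to an $l$-graph $(\Gamma,d')$ is a functor $\psi$ for which there is a homomorphism $\pi:\mathbb{N}^k\to\mathbb{N}^l$ with $\pi\circ d=d'\circ\psi$. A cubical set is a sequence of sets $(X_r)_{r\ge0}$ with maps $\partial_i^\ell:X_r\to X_{r-1}$ (faces; $\ell\in\{0,1\}$, $1\le i\le r$) and $f_i:X_{r-1}\to X_r$ (degeneracies; $1\le i\le r$) satisfying: $\partial_i^\ell\partial_j^m=\partial_j^m\partial_{i+1}^\ell$ if $j\le i$; $f_jf_i=f_{i+1}f_j$ if $j\le i$; and $\partial_i^\ell f_j=f_j\partial_{i-1}^\ell$ if $j<i$,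 $\partial_i^\ell f_i=\operatorname{id}$, $\partial_i^\ell f_j=f_{j-1}\partial_i^\ell$ if $j>i$. Write $\mathds{1}$-cubes as $\mathbb{1}_r$: $\mathbb{1}_r$ is the $r$-graph $\{(p,q)\in\mathbb{N}^r\times\mathbb{N}^r:p\le q\le\mathbf{1}_r\}$ with $r(p,q)=(p,p)$, $s(p,q)=(q,q)$, $d(p,q)=q-p$, $(p,q)(q,u)=(p,u)$ (a single vertex if $r=0$). For $1\le i\le r+1$, $\ell\in\{0,1\}$, $\varepsilon_i^\ell:\mathbb{N}^r\to\mathbb{N}^{r+1}$ inserts $\ell$: $\varepsilon^\ell_i(n_1,\dots,n_r)=(n_1,\dots,n_{i-1},\ell,n_i,\dots,n_r)$; for $r\ge1$, $1\le i\le r$, $\eta_i:\mathbb{N}^r\to\mathbb{N}^{r-1}$ deletes the $i$th coordinate. These extend to quasimorphisms $\varepsilon_i^\ell:\mathbb{1}_r\to\mathbb{1}_{r+1}$ and $\eta_i:\mathbb{1}_r\to\mathbb{1}_{r-1}$ by acting on both entries of $(m,n)$. A homomorphism $h:\mathbb{N}^r\to\mathbb{N}^k$ is admissible (of rank $t$) if there are $1\le i_1<\dots<i_t\le r$ and $1\le j_1<\dots<j_t\le k$ with $h(e_{i_p})=e_{j_p}$ for $p\le t$ and $h(e_i)=0$ for $i\notin\{i_1,\dots,i_t\}$. An $r$-cube in $\Lambda$ is a quasimorphism $\varphi:\mathbb{1}_r\to\Lambda$ for which there is an admissible $h:\mathbb{N}^r\to\mathbb{N}^k$ with $d_\Lambda\circ\varphi=h\circ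 d_{\mathbb{1}_r}$. $\widetilde{Q}_r(\Lambda)$ is the set of $r$-cubes. $\overline{\varepsilon}^\ell_i:\widetilde{Q}_{r+1}(\Lambda)\to\widetilde{Q}_r(\Lambda)$, $\overline{\varepsilon}^\ell_i(\varphi)=\varphi\circ\varepsilon^\ell_i$ for $1\le i\le r+1$; $\overline{\eta}_i:\widetilde{Q}_{r-1}(\Lambda)\to\widetilde{Q}_r(\Lambda)$, $\overline{\eta}_i(\varphi)=\varphi\circ\eta_i$ for $1\le i\le r$. *)

theory Defs
  imports "HOL-Library.FuncSet" "HOL-Library.Countable_Set" "HOL-Library.Function_Algebras"
begin

text \<open>
  An element of the monoid \<open>\<nat>\<^sup>k\<close> is a function on \<open>nat\<close> supported in \<open>{1..k}\<close>; addition, subtraction,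
  zero and the order are the pointwise ones of the function type, and \<open>Nvec 0 = {0}\<close>.
\<close>

definition Nvec :: "nat \<Rightarrow> (nat \<Rightarrow> nat) set" where
  "Nvec k = {n. \<forall>i. i \<notin> {1..k} \<longrightarrow> n i = 0}"

definition unit_vec :: "nat \<Rightarrow> nat \<Rightarrow> nat" where
  "unit_vec i = (\<lambda>j. if j = i then 1 else 0)"

definition ones :: "nat \<Rightarrow> nat \<Rightarrow> nat" where
  "ones r = (\<Sum>i = 1..r. unit_vec i)"

definition Nvec_hom :: "nat \<Rightarrow> nat \<Rightarrow> ((nat \<Rightarrow> nat) \<Rightarrow> (nat \<Rightarrow> nat)) \<Rightarrow> bool" where
  "Nvec_hom k l h \<longleftrightarrow> h \<in> Nvec k \<rightarrow> Nvec l \<and> h 0 = 0 \<and>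
     (\<forall>m\<in>Nvec k. \<forall>n\<in>Nvec k. h (m + n) = h m + h n)"

text \<open>
  Small categories in arrows-only form: objects are identified with their identity morphisms, so
  \<open>rng\<close> (codomain) and \<open>src\<close> (domain) take values in \<open>Mor\<close>. The composite \<open>cmp \<mu> \<nu>\<close>, written
  \<open>\<mu>\<nu>\<close> in the literature on higher-rank graphs, is meaningful if \<open>src \<mu> = rng \<nu>\<close>.
\<close>

record 'a graded_cat =
  Mor :: "'a set"
  rng :: "'a \<Rightarrow> 'a"
  src :: "'a \<Rightarrow> 'a"
  cmp :: "'a \<Rightarrow> 'a \<Rightarrow> 'a"
  deg :: "'a \<Rightarrow> (nat \<Rightarrow> nat)"

locale small_category =
  fixes C :: "'a graded_cat"
  assumes rng_closed: "x \<in> Mor C \<Longrightarrow> rng C x \<in> Mor C"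
    and src_closed: "x \<in> Mor C \<Longrightarrow> src C x \<in> Mor C"
    and rng_rng: "x \<in> Mor C \<Longrightarrow> rng C (rng C x) = rng C x"
    and src_rng: "x \<in> Mor C \<Longrightarrow> src C (rng C x) = rng C x"
    and rng_src: "x \<in> Mor C \<Longrightarrow> rng C (src C x) = src C x"
    and src_src: "x \<in> Mor C \<Longrightarrow> src C (src C x) = src C x"
    and cmp_closed: "\<lbrakk>x \<in> Mor C; y \<in> Mor C; src C x = rng C y\<rbrakk> \<Longrightarrow> cmp C x y \<in> Mor C"
    and rng_cmp: "\<lbrakk>x \<in> Mor C; y \<in> Mor C; src C x = rng C y\<rbrakk> \<Longrightarrow> rng C (cmp C x y) = rng C x"
    and src_cmp: "\<lbrakk>x \<in> Mor C; y \<in> Mor C; src C x = rng C y\<rbrakk> \<Longrightarrow> src C (cmp C x y) = src C y"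
    and cmp_assoc: "\<lbrakk>x \<in> Mor C; y \<in> Mor C; z \<in> Mor C; src C x = rng C y; src C y = rng C z\<rbrakk>
      \<Longrightarrow> cmp C (cmp C x y) z = cmp C x (cmp C y z)"
    and cmp_rng: "x \<in> Mor C \<Longrightarrow> cmp C (rng C x) x = x"
    and cmp_src: "x \<in> Mor C \<Longrightarrow> cmp C x (src C x) = x"

text \<open>
  \<open>deg_id\<close> and \<open>deg_cmp\<close> say that the degree is a functor into \<open>\<nat>\<^sup>k\<close> as a category with one object.
\<close>

locale k_graph = small_category \<Lambda> for k :: nat and \<Lambda> :: "'a graded_cat" +
  assumes nonempty: "Mor \<Lambda> \<noteq> {}"
    and countable: "countable (Mor \<Lambda>)"
    and deg_closed: "x \<in> Mor \<Lambda> \<Longrightarrow> deg \<Lambda> x \<in> Nvec k"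
    and deg_id: "x \<in> Mor \<Lambda> \<Longrightarrow> deg \<Lambda> (rng \<Lambda> x) = 0"
    and deg_cmp: "\<lbrakk>x \<in> Mor \<Lambda>; y \<in> Mor \<Lambda>; src \<Lambda> x = rng \<Lambda> y\<rbrakk>
      \<Longrightarrow> deg \<Lambda> (cmp \<Lambda> x y) = deg \<Lambda> x + deg \<Lambda> y"
    and factorisation: "\<lbrakk>x \<in> Mor \<Lambda>; m \<in> Nvec k; n \<in> Nvec k; deg \<Lambda> x = m + n\<rbrakk>
      \<Longrightarrow> \<exists>!p. case p of (\<mu>, \<nu>) \<Rightarrow> \<mu> \<in> Mor \<Lambda> \<and> \<nu> \<in> Mor \<Lambda> \<and> src \<Lambda> \<mu> = rng \<Lambda> \<nu> \<and>
            deg \<Lambda> \<mu> = m \<and> deg \<Lambda> \<nu> = n \<and> x = cmp \<Lambda> \<mu> \<nu>"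

definition is_functor :: "'a graded_cat \<Rightarrow> 'b graded_cat \<Rightarrow> ('a \<Rightarrow> 'b) \<Rightarrow> bool" where
  "is_functor C D \<psi> \<longleftrightarrow> \<psi> \<in> Mor C \<rightarrow> Mor D \<and>
     (\<forall>x\<in>Mor C. \<psi> (rng C x) = rng D (\<psi> x) \<and> \<psi> (src C x) = src D (\<psi> x)) \<and>
     (\<forall>x\<in>Mor C. \<forall>y\<in>Mor C. src C x = rng C y \<longrightarrow> \<psi> (cmp C x y) = cmp D (\<psi> x) (\<psi> y))"

definition quasimorphism ::
    "nat \<Rightarrow> 'a graded_cat \<Rightarrow> nat \<Rightarrow> 'b graded_cat \<Rightarrow> ('a \<Rightarrow> 'b) \<Rightarrow> bool" where
  "quasimorphism k \<Lambda> l \<Gamma> \<psi> \<longleftrightarrow> is_functor \<Lambda> \<Gamma> \<psi> \<and>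
     (\<exists>\<pi>. Nvec_hom k l \<pi> \<and> (\<forall>x\<in>Mor \<Lambda>. \<pi> (deg \<Lambda> x) = deg \<Gamma> (\<psi> x)))"

text \<open>
  \<open>face r l i\<close> is the face map \<open>\<partial>\<^sub>i\<^sup>l : X\<^sub>r\<^sub>+\<^sub>1 \<rightarrow> X\<^sub>r\<close> and \<open>degen r i\<close> the degeneracy
  \<open>f\<^sub>i : X\<^sub>r \<rightarrow> X\<^sub>r\<^sub>+\<^sub>1\<close>, both for \<open>1 \<le> i \<le> r + 1\<close>. The axioms range over exactly those indices for
  which all maps involved are defined.
\<close>

locale cubical_set =
  fixes X :: "nat \<Rightarrow> 'x set"
    and face :: "nat \<Rightarrow> nat \<Rightarrow> nat \<Rightarrow> 'x \<Rightarrow> 'x"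
    and degen :: "nat \<Rightarrow> nat \<Rightarrow> 'x \<Rightarrow> 'x"
  assumes face_closed: "\<lbrakk>1 \<le> i; i \<le> r + 1; l \<in> {0, 1}\<rbrakk> \<Longrightarrow> face r l i \<in> X (r + 1) \<rightarrow> X r"
    and degen_closed: "\<lbrakk>1 \<le> i; i \<le> r + 1\<rbrakk> \<Longrightarrow> degen r i \<in> X r \<rightarrow> X (r + 1)"
    and face_face: "\<lbrakk>1 \<le> j; j \<le> i; i \<le> r + 1; l \<in> {0, 1}; m \<in> {0, 1}; x \<in> X (r + 2)\<rbrakk>
      \<Longrightarrow> face r l i (face (r + 1) m j x) = face r m j (face (r + 1) l (i + 1) x)"
    and degen_degen: "\<lbrakk>1 \<le> j; j \<le> i; i \<le> r + 1; x \<in> X r\<rbrakk>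
      \<Longrightarrow> degen (r + 1) j (degen r i x) = degen (r + 1) (i + 1) (degen r j x)"
    and face_degen_less: "\<lbrakk>1 \<le> j; j < i; i \<le> r + 2; l \<in> {0, 1}; x \<in> X (r + 1)\<rbrakk>
      \<Longrightarrow> face (r + 1) l i (degen (r + 1) j x) = degen r j (face r l (i - 1) x)"
    and face_degen_eq: "\<lbrakk>1 \<le> i; i \<le> r + 1; l \<in> {0, 1}; x \<in> X r\<rbrakk>
      \<Longrightarrow> face r l i (degen r i x) = x"
    and face_degen_greater: "\<lbrakk>1 \<le> i; i < j; j \<le> r + 2; l \<in> {0, 1}; x \<in> X (r + 1)\<rbrakk>
      \<Longrightarrow> face (r + 1) l i (degen (r + 1) j x) = degen r (j - 1) (face r l i x)"

type_synonym cube_mor = "(nat \<Rightarrow> nat) \<times> (nat \<Rightarrow> nat)"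

definition cube_graph :: "nat \<Rightarrow> cube_mor graded_cat" where
  "cube_graph r = \<lparr>
     Mor = {(p, q). p \<in> Nvec r \<and> q \<in> Nvec r \<and> p \<le> q \<and> q \<le> ones r},
     rng = (\<lambda>(p, q). (p, p)),
     src = (\<lambda>(p, q). (q, q)),
     cmp = (\<lambda>(p, q) (q', u). (p, u)),
     deg = (\<lambda>(p, q). q - p)\<rparr>"

text \<open>
  Insertion of \<open>l\<close> as \<open>i\<close>-th coordinate, and deletion of the \<open>i\<close>-th coordinate (\<open>i \<ge> 1\<close>), on
  vectors and on pairs of vectors.
\<close>

definition insert_coord :: "nat \<Rightarrow> nat \<Rightarrow> (nat \<Rightarrow> nat) \<Rightarrow> (nat \<Rightarrow> nat)" where
  "insert_coord l i n = (\<lambda>j. if j < i then n j else if j = i then l else n (j - 1))"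

definition delete_coord :: "nat \<Rightarrow> (nat \<Rightarrow> nat) \<Rightarrow> (nat \<Rightarrow> nat)" where
  "delete_coord i n = (\<lambda>j. if j < i then n j else n (j + 1))"

definition eps :: "nat \<Rightarrow> nat \<Rightarrow> cube_mor \<Rightarrow> cube_mor" where
  "eps l i = map_prod (insert_coord l i) (insert_coord l i)"

definition eta :: "nat \<Rightarrow> cube_mor \<Rightarrow> cube_mor" where
  "eta i = map_prod (delete_coord i) (delete_coord i)"

definition admissible :: "nat \<Rightarrow> nat \<Rightarrow> ((nat \<Rightarrow> nat) \<Rightarrow> (nat \<Rightarrow> nat)) \<Rightarrow> bool" where
  "admissible r k h \<longleftrightarrow> Nvec_hom r k h \<and>
     (\<exists>(t::nat) (I::nat \<Rightarrow> nat) (J::nat \<Rightarrow> nat). strict_mono_on {1..t} I \<and> I \<in> {1..t} \<rightarrow> {1..r} \<and>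
              strict_mono_on {1..t} J \<and> J \<in> {1..t} \<rightarrow> {1..k} \<and>
              (\<forall>p\<in>{1..t}. h (unit_vec (I p)) = unit_vec (J p)) \<and>
              (\<forall>i\<in>{1..r} - I ` {1..t}. h (unit_vec i) = 0))"

text \<open>
  A cube is a map defined on \<open>Mor (cube_graph r)\<close> only, so it is taken to be \<open>extensional\<close> there:
  equality of HOL functions is then equality of cubes. Correspondingly, composition with
  \<open>eps l i\<close> and \<open>eta i\<close> is \<open>compose\<close>, which restricts the composite to the relevant domain.
\<close>

definition Qtilde :: "nat \<Rightarrow> 'a graded_cat \<Rightarrow> nat \<Rightarrow> (cube_mor \<Rightarrow> 'a) set" where
  "Qtilde k \<Lambda> r = {\<phi> \<in> extensional (Mor (cube_graph r)).
     quasimorphism r (cube_graph r) k \<Lambda> \<phi> \<and>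
     (\<exists>h. admissible r k h \<and>
        (\<forall>x\<in>Mor (cube_graph r). deg \<Lambda> (\<phi> x) = h (deg (cube_graph r) x)))}"

definition eps_bar :: "nat \<Rightarrow> nat \<Rightarrow> nat \<Rightarrow> (cube_mor \<Rightarrow> 'a) \<Rightarrow> (cube_mor \<Rightarrow> 'a)" where
  "eps_bar r l i \<phi> = compose (Mor (cube_graph r)) \<phi> (eps l i)"

definition eta_bar :: "nat \<Rightarrow> nat \<Rightarrow> (cube_mor \<Rightarrow> 'a) \<Rightarrow> (cube_mor \<Rightarrow> 'a)" where
  "eta_bar r i \<phi> = compose (Mor (cube_graph (r + 1))) \<phi> (eta i)"

end

theory Submission
  imports Defs "HOL-Library.Infinite_Set"
begin

text \<open>
  Every structure map of \<open>Qtilde k \<Lambda>\<close> is precomposition with a map of cubes that acts on both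
  entries of a pair by one and the same map of vectors: insertion of a coordinate for the faces,
  deletion of a coordinate for the degeneracies.

  Such a precomposition yields a cube again (\<open>compose_Qtilde\<close>) because the degree of the image of
  \<open>(p, q)\<close> is obtained from \<open>q - p\<close> by an admissible homomorphism: inserting the constant \<open>l\<close> at
  place \<open>i\<close> in both entries inserts \<open>0\<close> in the difference, and deletion is additive. Admissible
  homomorphisms are closed under composition (\<open>admissible_comp\<close>), which is transparent once an
  admissible homomorphism is regarded as a strictly increasing partial map of index sets
  (\<open>admissible_iff\<close>).

  Since precomposition is contravariant and all the maps of cubes respect domains, each cubical
  identity reduces to the opposite identity between insertions and deletions of coordinates, which
  is checked coordinate by coordinate. That a degenerate cube has the original cube as its face
  uses, in addition, that cubes are extensional functions.
\<close>

section \<open>Insertion and deletion of coordinates\<close>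

lemma ones_apply: "ones r j = (if j \<in> {1..r} then 1 else 0)"
proof (induction r)
  case 0
  then show ?case by (simp add: ones_def)
next
  case (Suc r)
  have "ones (Suc r) = ones r + unit_vec (Suc r)"
    by (simp add: ones_def)
  with Suc show ?case by (auto simp: unit_vec_def)
qed

lemma insert_insert:
  "j \<le> i \<Longrightarrow> insert_coord m j (insert_coord l i n) = insert_coord l (i + 1) (insert_coord m j n)"
  by (auto simp: insert_coord_def fun_eq_iff)

lemma delete_delete:
  "j \<le> i \<Longrightarrow> delete_coord i (delete_coord j n) = delete_coord j (delete_coord (i + 1) n)"
  by (auto simp: delete_coord_def fun_eq_iff)

lemma delete_insert_less:
  "j < i \<Longrightarrow> delete_coord j (insert_coord l i n) = insert_coord l (i - 1) (delete_coord j n)"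
  by (auto simp: delete_coord_def insert_coord_def fun_eq_iff)

lemma delete_insert_eq: "delete_coord i (insert_coord l i n) = n"
  by (auto simp: delete_coord_def insert_coord_def fun_eq_iff)

lemma delete_insert_greater:
  "i < j \<Longrightarrow> delete_coord j (insert_coord l i n) = insert_coord l i (delete_coord (j - 1) n)"
  by (auto simp: delete_coord_def insert_coord_def fun_eq_iff)

lemma insert_coord_diff:
  "insert_coord l i q - insert_coord l i p = insert_coord 0 i (q - p)"
  by (auto simp: insert_coord_def fun_eq_iff)

lemma delete_coord_diff: "delete_coord i q - delete_coord i p = delete_coord i (q - p)"
  by (auto simp: delete_coord_def fun_eq_iff)

lemma insert_coord_Nvec:
  assumes "1 \<le> i" "i \<le> r + 1" "n \<in> Nvec r"
  shows "insert_coord 0 i n \<in> Nvec (r + 1)"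
proof -
  have "n j = 0" "n (j - 1) = 0" if "j = 0 \<or> j > r + 1" for j
    using assms(3) that by (auto simp: Nvec_def Suc_le_eq)
  moreover have "n j = 0" if "j > r" for j
    using assms(3) that by (auto simp: Nvec_def)
  ultimately show ?thesis
    using assms(1,2) by (auto simp: Nvec_def insert_coord_def)
qed

lemma delete_coord_Nvec:
  "\<lbrakk>1 \<le> i; i \<le> r + 1; n \<in> Nvec (r + 1)\<rbrakk> \<Longrightarrow> delete_coord i n \<in> Nvec r"
  by (auto simp: Nvec_def delete_coord_def)

lemma mem_cube_graph_iff:
  "(p, q) \<in> Mor (cube_graph r) \<longleftrightarrow> (\<forall>j. p j \<le> q j) \<and> (\<forall>j. q j \<le> (if j \<in> {1..r} then 1 else 0))"
proof -
  have "p \<in> Nvec r" "q \<in> Nvec r" if "\<forall>j. p j \<le> q j" "\<forall>j. q j \<le> (if j \<in> {1..r} then 1 else 0)"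
  proof -
    have "p j = 0" "q j = 0" if "j \<notin> {1..r}" for j
      using that \<open>\<forall>j. p j \<le> q j\<close>[rule_format, of j]
        \<open>\<forall>j. q j \<le> (if j \<in> {1..r} then 1 else 0)\<close>[rule_format, of j]
      by (simp_all del: atLeastAtMost_iff)
    then show "p \<in> Nvec r" "q \<in> Nvec r"
      by (auto simp: Nvec_def)
  qed
  then show ?thesis
    by (auto simp: cube_graph_def le_fun_def ones_apply)
qed

lemma map_prod_insert_cube:
  assumes i: "1 \<le> i" "i \<le> r + 1" and l: "l \<in> {0, 1}" and x: "x \<in> Mor (cube_graph r)"
  shows "map_prod (insert_coord l i) (insert_coord l i) x \<in> Mor (cube_graph (r + 1))"
proof -
  obtain p q where x_eq: "x = (p, q)" by fastforce
  have p: "p j \<le> q j" and q: "q j \<le> (if j \<in> {1..r} then 1 else 0)" for j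
    using x by (auto simp: x_eq mem_cube_graph_iff)
  have "insert_coord l i q j \<le> (if j \<in> {1..r + 1} then 1 else 0)" for j
    using i l q[of j] q[of "j - 1"] by (auto simp: insert_coord_def split: if_splits)
  with p show ?thesis
    by (simp add: x_eq mem_cube_graph_iff insert_coord_def)
qed

lemma map_prod_delete_cube:
  assumes i: "1 \<le> i" "i \<le> r + 1" and x: "x \<in> Mor (cube_graph (r + 1))"
  shows "map_prod (delete_coord i) (delete_coord i) x \<in> Mor (cube_graph r)"
proof -
  obtain p q where x_eq: "x = (p, q)" by fastforce
  have p: "p j \<le> q j" and q: "q j \<le> (if j \<in> {1..r + 1} then 1 else 0)" for j
    using x by (auto simp: x_eq mem_cube_graph_iff)
  have "delete_coord i q j \<le> (if j \<in> {1..r} then 1 else 0)" for j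
    using i q[of j] q[of "j + 1"] by (auto simp: delete_coord_def split: if_splits)
  with p show ?thesis
    by (simp add: x_eq mem_cube_graph_iff delete_coord_def)
qed

section \<open>Admissible homomorphisms\<close>

text \<open>
  The enumerations of the two index families enter only through the strictly increasing bijection
  \<open>g\<close> between their ranges. In terms of \<open>g\<close>, composing admissible homomorphisms is composing partial
  maps, with no renumbering.
\<close>

lemma admissible_iff:
  "admissible r k h \<longleftrightarrow> Nvec_hom r k h \<and>
     (\<exists>A g. A \<subseteq> {1..r} \<and> strict_mono_on A g \<and> g \<in> A \<rightarrow> {1..k} \<and>
        (\<forall>i\<in>A. h (unit_vec i) = unit_vec (g i)) \<and> (\<forall>i\<in>{1..r} - A. h (unit_vec i) = 0))"
  (is "_ \<longleftrightarrow> _ \<and> ?R")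
proof -
  let ?P = "\<lambda>(t::nat) I J. strict_mono_on {1..t} I \<and> I \<in> {1..t} \<rightarrow> {1..r} \<and>
      strict_mono_on {1..t} J \<and> J \<in> {1..t} \<rightarrow> {1..k} \<and>
      (\<forall>p\<in>{1..t}. h (unit_vec (I p)) = unit_vec (J p)) \<and>
      (\<forall>i\<in>{1..r} - I ` {1..t}. h (unit_vec i) = 0)"
  have "(\<exists>t I J. ?P t I J) \<longleftrightarrow> ?R"
  proof
    assume "\<exists>t I J. ?P t I J"
    then obtain t I J where IJ: "?P t I J" by (elim exE)
    let ?A = "I ` {1..t}" and ?g = "J \<circ> inv_into {1..t} I"
    have I: "strict_mono_on {1..t} I" and J: "strict_mono_on {1..t} J"
      using IJ by simp_all
    have inj: "inj_on I {1..t}"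
      using I by (rule strict_mono_on_imp_inj_on)
    have "J p < J q" if "p \<in> {1..t}" "q \<in> {1..t}" "I p < I q" for p q
    proof -
      have "p < q" using that I by (metis strict_mono_on_less)
      then show ?thesis using that J by (simp add: monotone_on_def)
    qed
    then have "strict_mono_on ?A ?g"
      using inj by (auto intro!: strict_mono_onI)
    moreover have "?A \<subseteq> {1..r}" "?g \<in> ?A \<rightarrow> {1..k}" "\<forall>i\<in>?A. h (unit_vec i) = unit_vec (?g i)"
      using IJ inj by auto
    moreover have "\<forall>i\<in>{1..r} - ?A. h (unit_vec i) = 0"
      using IJ by (elim conjE)
    ultimately show ?R by (intro exI conjI)
  next
    assume ?R
    then obtain A g where A: "A \<subseteq> {1..r}" and g: "strict_mono_on A g" "g \<in> A \<rightarrow> {1..k}"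
      and h: "\<forall>i\<in>A. h (unit_vec i) = unit_vec (g i)" "\<forall>i\<in>{1..r} - A. h (unit_vec i) = 0"
      by (elim exE conjE)
    have "finite A" using A finite_subset by blast
    then obtain e where e: "bij_betw e {..<card A} A" "strict_mono_on {..<card A} e"
      by (rule ex_bij_betw_strict_mono_card)
    \<comment> \<open>\<open>e\<close> enumerates \<open>A\<close> from \<open>0\<close>, whereas admissibility numbers the indices from \<open>1\<close>\<close>
    define I where "I p = e (p - 1)" for p
    have mono: "strict_mono_on {1..card A} I"
      using e(2) by (auto simp: monotone_on_def I_def)
    have "I ` {1..card A} = e ` (\<lambda>p. p - 1) ` {1..card A}"
      by (simp add: I_def image_image)
    also have "(\<lambda>p. p - 1) ` {1..card A} = {..<card A}"
      by (auto simp: image_iff intro!: bexI[of _ "Suc _"])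
    also have "e ` {..<card A} = A"
      using e(1) by (simp add: bij_betw_def)
    finally have im: "I ` {1..card A} = A" .
    have mem: "I p \<in> A" if "p \<in> {1..card A}" for p
      using im that by blast
    have "strict_mono_on {1..card A} (g \<circ> I)"
      using mono mem g(1) by (simp add: monotone_on_def)
    moreover have "I \<in> {1..card A} \<rightarrow> {1..r}" "g \<circ> I \<in> {1..card A} \<rightarrow> {1..k}"
      using mem A g(2) by auto
    moreover have "\<forall>p\<in>{1..card A}. h (unit_vec (I p)) = unit_vec ((g \<circ> I) p)"
      using mem h(1) by simp
    ultimately have "?P (card A) I (g \<circ> I)"
      using mono h(2) unfolding im by (intro conjI)
    then show "\<exists>t I J. ?P t I J" by (intro exI)
  qed
  then show ?thesis
    unfolding admissible_def by (rule conj_cong[OF refl])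
qed

lemma Nvec_hom_comp:
  assumes "Nvec_hom r s u" "Nvec_hom s k h"
  shows "Nvec_hom r k (h \<circ> u)"
  using assms by (auto simp: Nvec_hom_def Pi_iff)

lemma admissible_comp:
  assumes "admissible r s u" "admissible s k h"
  shows "admissible r k (h \<circ> u)"
proof -
  obtain A f where u: "Nvec_hom r s u" and A: "A \<subseteq> {1..r}" "strict_mono_on A f" "f \<in> A \<rightarrow> {1..s}"
      "\<forall>i\<in>A. u (unit_vec i) = unit_vec (f i)" "\<forall>i\<in>{1..r} - A. u (unit_vec i) = 0"
    using assms(1) unfolding admissible_iff by blast
  obtain B g where h: "Nvec_hom s k h" and B: "strict_mono_on B g" "g \<in> B \<rightarrow> {1..k}"
      "\<forall>i\<in>B. h (unit_vec i) = unit_vec (g i)" "\<forall>i\<in>{1..s} - B. h (unit_vec i) = 0"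
    using assms(2) unfolding admissible_iff by blast
  let ?C = "{i \<in> A. f i \<in> B}"
  have "?C \<subseteq> {1..r}" "g \<circ> f \<in> ?C \<rightarrow> {1..k}"
    using A(1) B(2) by auto
  moreover have "strict_mono_on ?C (g \<circ> f)"
    using A(2) B(1) by (auto simp: monotone_on_def)
  moreover have "\<forall>i\<in>?C. (h \<circ> u) (unit_vec i) = unit_vec ((g \<circ> f) i)"
    using A(4) B(3) by auto
  moreover have "\<forall>i\<in>{1..r} - ?C. (h \<circ> u) (unit_vec i) = 0"
  proof
    fix i assume i: "i \<in> {1..r} - ?C"
    have "h 0 = 0" using h by (simp add: Nvec_hom_def)
    then show "(h \<circ> u) (unit_vec i) = 0"
      using i A(3-5) B(4) by (cases "i \<in> A") (auto simp: Pi_iff)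
  qed
  ultimately show ?thesis
    unfolding admissible_iff using Nvec_hom_comp[OF u h] by blast
qed

lemma admissible_insert_coord:
  assumes "1 \<le> i" "i \<le> r + 1"
  shows "admissible r (r + 1) (insert_coord 0 i)"
proof -
  let ?g = "\<lambda>j. if j < i then j else j + 1"
  have "Nvec_hom r (r + 1) (insert_coord 0 i)"
    using insert_coord_Nvec[OF assms] by (auto simp: Nvec_hom_def insert_coord_def fun_eq_iff)
  moreover have "strict_mono_on {1..r} ?g" "?g \<in> {1..r} \<rightarrow> {1..r + 1}"
    by (auto intro!: strict_mono_onI)
  moreover have "\<forall>j\<in>{1..r}. insert_coord 0 i (unit_vec j) = unit_vec (?g j)"
    by (auto simp: insert_coord_def unit_vec_def fun_eq_iff)
  ultimately show ?thesis
    unfolding admissible_iff by blast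
qed

lemma admissible_delete_coord:
  assumes "1 \<le> i" "i \<le> r + 1"
  shows "admissible (r + 1) r (delete_coord i)"
proof -
  let ?A = "{1..r + 1} - {i}" and ?g = "\<lambda>j. if j < i then j else j - 1"
  have "Nvec_hom (r + 1) r (delete_coord i)"
    using delete_coord_Nvec[OF assms] by (auto simp: Nvec_hom_def delete_coord_def fun_eq_iff)
  moreover have "strict_mono_on ?A ?g" "?g \<in> ?A \<rightarrow> {1..r}"
    using assms by (auto simp: monotone_on_def split: if_splits)
  moreover have "\<forall>j\<in>?A. delete_coord i (unit_vec j) = unit_vec (?g j)"
    by (auto simp: delete_coord_def unit_vec_def fun_eq_iff)
  moreover have "\<forall>j\<in>{1..r + 1} - ?A. delete_coord i (unit_vec j) = 0"
    by (auto simp: delete_coord_def unit_vec_def fun_eq_iff)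
  ultimately show ?thesis
    unfolding admissible_iff by blast
qed

section \<open>Precomposition of cubes\<close>

text \<open>
  The hypothesis on differences says that precomposition changes the degree by \<open>u\<close>, so that \<open>h \<circ> u\<close>
  is an admissible homomorphism for the new cube if \<open>h\<close> is one for \<open>\<phi>\<close>.
  A map of the form \<open>map_prod f f\<close> commutes with range, source and composition of pairs for any
  \<open>f\<close>; hence functoriality needs only that it sends morphisms to morphisms.
\<close>

lemma compose_Qtilde:
  assumes maps: "\<And>x. x \<in> Mor (cube_graph r) \<Longrightarrow> map_prod f f x \<in> Mor (cube_graph s)"
    and diff: "\<And>p q. f q - f p = u (q - p)"
    and u: "admissible r s u"
    and \<phi>: "\<phi> \<in> Qtilde k \<Lambda> s"
  shows "compose (Mor (cube_graph r)) \<phi> (map_prod f f) \<in> Qtilde k \<Lambda> r"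
proof -
  let ?R = "cube_graph r" and ?S = "cube_graph s" and ?F = "map_prod f f"
  let ?\<psi> = "compose (Mor ?R) \<phi> ?F"
  obtain h where \<phi>_fun: "is_functor ?S \<Lambda> \<phi>" and h: "admissible s k h"
    and deg: "\<And>x. x \<in> Mor ?S \<Longrightarrow> deg \<Lambda> (\<phi> x) = h (deg ?S x)"
    using \<phi> by (auto simp: Qtilde_def quasimorphism_def)
  have F: "rng ?S (?F x) = ?F (rng ?R x)" "src ?S (?F x) = ?F (src ?R x)"
      "cmp ?S (?F x) (?F y) = ?F (cmp ?R x y)" "deg ?S (?F x) = u (deg ?R x)" for x y
    by (auto simp: cube_graph_def diff split: prod.splits)
  have R: "rng ?R x \<in> Mor ?R" "src ?R x \<in> Mor ?R" if "x \<in> Mor ?R" for x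
    using that by (auto simp: cube_graph_def intro: order_trans)
  have R_cmp: "cmp ?R x y \<in> Mor ?R" if "x \<in> Mor ?R" "y \<in> Mor ?R" "src ?R x = rng ?R y" for x y
    using that by (auto simp: cube_graph_def intro: order_trans)
  have \<psi>: "?\<psi> x = \<phi> (?F x)" if "x \<in> Mor ?R" for x
    using that by (simp add: compose_eq)
  have \<psi>_fun: "is_functor ?R \<Lambda> ?\<psi>"
    unfolding is_functor_def
  proof (intro conjI ballI impI)
    show "?\<psi> \<in> Mor ?R \<rightarrow> Mor \<Lambda>"
      using \<phi>_fun maps by (auto simp: \<psi> is_functor_def Pi_iff)
  next
    fix x assume x: "x \<in> Mor ?R"
    show "?\<psi> (rng ?R x) = rng \<Lambda> (?\<psi> x)" "?\<psi> (src ?R x) = src \<Lambda> (?\<psi> x)"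
      using \<phi>_fun maps[OF x] by (simp_all add: \<psi> x R is_functor_def flip: F(1,2))
  next
    fix x y assume xy: "x \<in> Mor ?R" "y \<in> Mor ?R" "src ?R x = rng ?R y"
    have "src ?S (?F x) = rng ?S (?F y)"
      by (simp only: F xy(3))
    then show "?\<psi> (cmp ?R x y) = cmp \<Lambda> (?\<psi> x) (?\<psi> y)"
      using \<phi>_fun maps[OF xy(1)] maps[OF xy(2)]
      by (simp add: \<psi> xy(1,2) R_cmp[OF xy] is_functor_def flip: F(3))
  qed
  have \<psi>_deg: "deg \<Lambda> (?\<psi> x) = (h \<circ> u) (deg ?R x)" if "x \<in> Mor ?R" for x
    using that maps[OF that] by (simp add: \<psi> deg F)
  have hu: "admissible r k (h \<circ> u)"
    by (rule admissible_comp[OF u h])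
  then have "Nvec_hom r k (h \<circ> u)" by (simp add: admissible_def)
  with \<psi>_fun \<psi>_deg hu show ?thesis
    unfolding Qtilde_def quasimorphism_def
    by (auto simp: compose_extensional intro!: exI[of _ "h \<circ> u"])
qed

text \<open>
  The inner restriction is harmless because \<open>G\<close> takes values in \<open>B\<close>.
\<close>

lemma compose_compose:
  assumes "G \<in> A \<rightarrow> B"
  shows "compose A (compose B \<phi> F) G = compose A \<phi> (F \<circ> G)"
  using assms by (auto simp: compose_def fun_eq_iff Pi_iff)

lemma eps_cube:
  "\<lbrakk>1 \<le> i; i \<le> r + 1; l \<in> {0, 1}\<rbrakk> \<Longrightarrow> eps l i \<in> Mor (cube_graph r) \<rightarrow> Mor (cube_graph (r + 1))"
  unfolding eps_def by (rule Pi_I) (rule map_prod_insert_cube)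

lemma eta_cube:
  "\<lbrakk>1 \<le> i; i \<le> r + 1\<rbrakk> \<Longrightarrow> eta i \<in> Mor (cube_graph (r + 1)) \<rightarrow> Mor (cube_graph r)"
  unfolding eta_def by (rule Pi_I) (rule map_prod_delete_cube)

section \<open>The cubical identities\<close>

theorem theoremA4:
  fixes k :: nat and \<Lambda> :: "'a graded_cat"
  assumes "k_graph k \<Lambda>"
  shows "cubical_set (Qtilde k \<Lambda>) eps_bar eta_bar"
proof
  fix i r l :: nat
  assume i: "1 \<le> i" "i \<le> r + 1" and l: "l \<in> {0, 1}"
  show "eps_bar r l i \<in> Qtilde k \<Lambda> (r + 1) \<rightarrow> Qtilde k \<Lambda> r"
    unfolding eps_bar_def eps_def
    by (intro Pi_I compose_Qtilde[OF _ insert_coord_diff admissible_insert_coord]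
          map_prod_insert_cube i l)
next
  fix i r :: nat
  assume i: "1 \<le> i" "i \<le> r + 1"
  show "eta_bar r i \<in> Qtilde k \<Lambda> r \<rightarrow> Qtilde k \<Lambda> (r + 1)"
    unfolding eta_bar_def eta_def
    by (intro Pi_I compose_Qtilde[OF _ delete_coord_diff admissible_delete_coord]
          map_prod_delete_cube i)
next
  fix i j r l m :: nat and x
  assume "1 \<le> j" "j \<le> i" "i \<le> r + 1" "l \<in> {0, 1}" "m \<in> {0, 1}"
  moreover from this have "eps m j \<circ> eps l i = eps l (i + 1) \<circ> eps m j"
    by (simp add: eps_def fun_eq_iff insert_insert)
  ultimately show "eps_bar r l i (eps_bar (r + 1) m j x) = eps_bar r m j (eps_bar (r + 1) l (i + 1) x)"
    using eps_cube[of i r l] eps_cube[of j r m]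
    unfolding eps_bar_def by (simp add: compose_compose)
next
  fix i j r :: nat and x
  assume "1 \<le> j" "j \<le> i" "i \<le> r + 1"
  moreover from this have "eta i \<circ> eta j = eta j \<circ> eta (i + 1)"
    by (simp add: eta_def fun_eq_iff delete_delete)
  ultimately show "eta_bar (r + 1) j (eta_bar r i x) = eta_bar (r + 1) (i + 1) (eta_bar r j x)"
    using eta_cube[of j "r + 1"] eta_cube[of "i + 1" "r + 1"]
    unfolding eta_bar_def by (simp add: compose_compose)
next
  fix i j r l :: nat and x
  assume "1 \<le> j" "j < i" "i \<le> r + 2" "l \<in> {0, 1}"
  moreover from this have "eta j \<circ> eps l i = eps l (i - 1) \<circ> eta j"
    by (simp add: eta_def eps_def fun_eq_iff delete_insert_less)
  ultimately show "eps_bar (r + 1) l i (eta_bar (r + 1) j x) = eta_bar r j (eps_bar r l (i - 1) x)"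
    using eps_cube[of i "r + 1" l] eta_cube[of j r]
    unfolding eta_bar_def eps_bar_def by (simp add: compose_compose)
next
  fix i r l :: nat and x
  assume "1 \<le> i" "i \<le> r + 1" "l \<in> {0, 1}" and x: "x \<in> Qtilde k \<Lambda> r"
  moreover have "eta i \<circ> eps l i = id"
    by (simp add: eta_def eps_def fun_eq_iff delete_insert_eq)
  moreover have "compose (Mor (cube_graph r)) x id = x"
    using x by (auto simp: compose_def Qtilde_def extensional_def fun_eq_iff)
  ultimately show "eps_bar r l i (eta_bar r i x) = x"
    unfolding eta_bar_def eps_bar_def by (simp only: compose_compose[OF eps_cube])
next
  fix i j r l :: nat and x
  assume "1 \<le> i" "i < j" "j \<le> r + 2" "l \<in> {0, 1}"
  moreover from this have "eta j \<circ> eps l i = eps l i \<circ> eta (j - 1)"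
    by (simp add: eta_def eps_def fun_eq_iff delete_insert_greater)
  ultimately show "eps_bar (r + 1) l i (eta_bar (r + 1) j x) = eta_bar r (j - 1) (eps_bar r l i x)"
    using eps_cube[of i "r + 1" l] eta_cube[of "j - 1" r]
    unfolding eta_bar_def eps_bar_def by (simp add: compose_compose)
qed

end
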